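(* Let $T \in \mathbb{N} \cup \{+\infty\}$, $\mathbb{N}_{\le T} = \{0,\dots,T\}$ (or $\mathbb{N}$ if $T=+\infty$), and $\mathbb{N}_{\le T-1}$ defined analogously. Consider random regressors $M_t \in \mathbb{R}^{m\times n}$, outputs $y_{t+1}\in\mathbb{R}^m$ and noise $w_t \in \mathbb{R}^m$ with $y_{t+1} = M_t\theta^\star + w_t$ for $t \in \mathbb{N}_{\le T-1}$, where $\theta^\star\in\mathbb{R}^n$ is deterministic and unknown. Let $\mathcal{D}_t = \{M_0,y_1,M_1,\dots,y_t,M_t\}$, $W \succ 0$ a symmetric positive definite $m\times m$ matrix, $\mu\in\mathbb{R}^n$, and $P\in\mathbb{R}^{n\times n}$ symmetric positive definite. Let $V_t = \sum_{k=0}^{t-1} M_k^\top W M_k$ and let $\hat\theta_t$ be the unique minimizer of $$\|\theta-\mu\|_P^2 + \sum_{k=0}^{t-1}\|y_{k+1}-M_k\theta\|_W^2,$$ i.e. $\hat\theta_t = (P+V_t)^{-1}\left(P\mu + \sum_{k=0}^{t-1} M_k^\top W y_{k+1}\right)$. Assume (i) for a known $c_w>0$ and all $t\in\mathbb{N}_{\le T-1}$, $\mathbb{E}[e^{\nu^\top w_t}\mid\mathcal{D}_t] \le e^{\frac12 c_w^2\nu^\top W^{-1}\nu}$ for all $\nu\in\mathbb{R}^m$; and (ii) for a known $c_\theta\ge 0$, $\|\theta^\star-\mu\|_P \le c_\theta$. Let $\delta\in(0,1)$ and $$\beta_t = \sqrt{c_\theta^2 + c_w^2\log\left|I_n + P^{-1}V_t\right|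 + 2c_w^2\log(1/\delta)}.$$ Then $$\mathbb{P}\left[\|\theta^\star - \hat\theta_t\|_{P+V_t} \le \beta_t,\ \forall t\in\mathbb{N}_{\le T}\right] \ge 1-\delta.$$
   Context: For a symmetric positive definite $A$, $\|x\|_A^2 = x^\top A x$; $|A|$ denotes the determinant. The probability is over the data-generation process; $\theta^\star$ is deterministic. *)

theory Defs
  imports "HOL-Probability.Probability" "HOL-Library.Extended_Nat"
begin

definition wnorm :: "real ^ 'n \<Rightarrow> real ^ 'n ^ 'n \<Rightarrow> real" where
  "wnorm x A = sqrt (x \<bullet> (A *v x))"

definition sym_pos_def :: "real ^ 'n ^ 'n \<Rightarrow> bool" where
  "sym_pos_def A \<longleftrightarrow> transpose A = A \<and> (\<forall>x. x \<noteq> 0 \<longrightarrow> x \<bullet> (A *v x) > 0)"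

definition info_alg ::
  "'a measure \<Rightarrow> (nat \<Rightarrow> 'a \<Rightarrow> real ^ 'n ^ 'm) \<Rightarrow> (nat \<Rightarrow> 'a \<Rightarrow> real ^ 'm) \<Rightarrow> nat \<Rightarrow> 'a measure" where
  "info_alg \<Omega> Mr y t = sigma (space \<Omega>)
     ((\<Union>k\<in>{0..t}. {Mr k -` A \<inter> space \<Omega> | A. A \<in> sets borel})
      \<union> (\<Union>k\<in>{1..t}. {y k -` A \<inter> space \<Omega> | A. A \<in> sets borel}))"

definition Vmat :: "(nat \<Rightarrow> 'a \<Rightarrow> real ^ 'n ^ 'm) \<Rightarrow> real ^ 'm ^ 'm \<Rightarrow> nat \<Rightarrow> 'a \<Rightarrow> real ^ 'n ^ 'n" where
  "Vmat Mr W t \<omega> = (\<Sum>k<t. transpose (Mr k \<omega>) ** W ** Mr k \<omega>)"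

definition theta_hat ::
  "(nat \<Rightarrow> 'a \<Rightarrow> real ^ 'n ^ 'm) \<Rightarrow> (nat \<Rightarrow> 'a \<Rightarrow> real ^ 'm) \<Rightarrow> real ^ 'm ^ 'm \<Rightarrow>
   real ^ 'n \<Rightarrow> real ^ 'n ^ 'n \<Rightarrow> nat \<Rightarrow> 'a \<Rightarrow> real ^ 'n" where
  "theta_hat Mr y W \<mu> P t \<omega> =
     matrix_inv (P + Vmat Mr W t \<omega>) *v
       (P *v \<mu> + (\<Sum>k<t. (transpose (Mr k \<omega>) ** W) *v y (Suc k) \<omega>))"

definition beta_rad ::
  "real \<Rightarrow> real \<Rightarrow> real \<Rightarrow> real ^ 'n ^ 'n \<Rightarrow> real ^ 'n ^ 'n \<Rightarrow> real" where
  "beta_rad c\<theta> cw \<delta> P V =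
     sqrt (c\<theta>\<^sup>2 + cw\<^sup>2 * ln (det (mat 1 + matrix_inv P ** V)) + 2 * cw\<^sup>2 * ln (1 / \<delta>))"

end

theory Submission
  imports Defs
begin

text \<open>
  Method of mixtures. Put \<open>S\<^sub>t = (\<Sum>k<t. M\<^sub>k\<^sup>T W w\<^sub>k)\<close>. For every fixed \<open>l\<close> the sub-Gaussian bound in
  the direction \<open>W M\<^sub>t l / c\<^sup>2\<close> makes \<open>exp ((l \<bullet> S\<^sub>t - l \<bullet> V\<^sub>t l / 2) / c\<^sup>2)\<close> a supermartingale, hence
  so is its mixture over the Gaussian weight \<open>exp ((l \<bullet> P (\<mu> - \<theta>) - l \<bullet> P l / 2) / c\<^sup>2)\<close>, whose centre is
  \<open>\<mu> - \<theta>\<close> rather than \<open>0\<close>; centring it there is what puts \<open>c\<theta>\<^sup>2\<close> under the square root of the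
  radius instead of adding \<open>c\<theta>\<close> outside. With \<open>A = P + V\<^sub>t\<close> and \<open>e\<close> the estimation error,
  completing the square evaluates the mixture to a constant times
  \<open>exp (e \<bullet> A e / (2 c\<^sup>2)) / sqrt (det A)\<close>, so that the confidence bound at time \<open>t\<close> holds if and
  only if the mixture is below a fixed threshold, and the maximal inequality for nonnegative
  supermartingales applies.
\<close>

section \<open>Linear changes of variables for Lebesgue measure\<close>

lemma Basis_vec_real: "(Basis :: (real ^ 'n) set) = range (\<lambda>i. axis i 1)"
  by (auto simp: Basis_vec_def)

lemma inj_axis_one: "inj (\<lambda>i. axis i (1::real) :: real ^ 'n)"
  by (auto simp: inj_on_def axis_eq_axis)

lemma borel_measurable_matrix_vector_mult:
  fixes f :: "'a \<Rightarrow> real ^ 'n ^ 'm"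
  assumes "f \<in> borel_measurable M" "g \<in> borel_measurable M"
  shows "(\<lambda>x. f x *v g x) \<in> borel_measurable M"
  using assms unfolding matrix_vector_mult_def
  by (rule borel_measurable_continuous_Pair) (intro continuous_intros)

lemma borel_measurable_matrix_matrix_mult:
  fixes f :: "'a \<Rightarrow> real ^ 'n ^ 'm" and g :: "'a \<Rightarrow> real ^ 'k ^ 'n"
  assumes "f \<in> borel_measurable M" "g \<in> borel_measurable M"
  shows "(\<lambda>x. f x ** g x) \<in> borel_measurable M"
  using assms unfolding matrix_matrix_mult_def
  by (rule borel_measurable_continuous_Pair) (intro continuous_intros)

lemma borel_measurable_transpose:
  fixes f :: "'a \<Rightarrow> real ^ 'n ^ 'm"
  assumes "f \<in> borel_measurable M"
  shows "(\<lambda>x. transpose (f x)) \<in> borel_measurable M"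
proof -
  have "transpose \<in> borel_measurable (borel :: (real ^ 'n ^ 'm) measure)"
    unfolding transpose_def by (intro borel_measurable_continuous_onI continuous_intros)
  then show ?thesis using assms by (rule measurable_compose_rev)
qed

lemmas matrix_measurable [measurable (raw)] =
  borel_measurable_matrix_vector_mult borel_measurable_matrix_matrix_mult borel_measurable_transpose

text \<open>Integrate the coordinate along \<open>b\<close> innermost: there the shift
  \<open>g x\<close> is constant, so translation invariance of one-dimensional Lebesgue measure
  suffices.\<close>

lemma nn_integral_lborel_shear:
  fixes f :: "'a::euclidean_space \<Rightarrow> ennreal" and g :: "'a \<Rightarrow> real"
  assumes b: "b \<in> Basis" and f[measurable]: "f \<in> borel_measurable borel"
    and g[measurable]: "g \<in> borel_measurable borel" and g_b: "\<And>x s. g (x + s *\<^sub>R b) = g x"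
  shows "(\<integral>\<^sup>+x. f (x + g x *\<^sub>R b) \<partial>lborel) = (\<integral>\<^sup>+x. f x \<partial>lborel)"
proof -
  interpret product_sigma_finite "\<lambda>_::'a. lborel :: real measure" ..
  define T :: "('a \<Rightarrow> real) \<Rightarrow> 'a" where "T = (\<lambda>x. \<Sum>i\<in>Basis. x i *\<^sub>R i)"
  \<comment> \<open>\<open>T\<close> rebuilds a vector from its coordinates; \<open>U\<close> zeroes
    the one along \<open>b\<close>, which becomes the inner integration variable.\<close>
  define U where "U x = T (x(b := 0))" for x
  have T_meas[measurable]: "T \<in> borel_measurable (\<Pi>\<^sub>M b\<in>Basis. lborel)"
    unfolding T_def by measurable
  have lborel_T: "(\<integral>\<^sup>+x. h x \<partial>lborel)
      = (\<integral>\<^sup>+x. \<integral>\<^sup>+y. h (U x + y *\<^sub>R b) \<partial>lborel \<partial>(\<Pi>\<^sub>M b\<in>Basis - {b}. lborel))"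
    if [measurable]: "h \<in> borel_measurable borel" for h :: "'a \<Rightarrow> ennreal"
  proof -
    have upd: "T (x(b := y)) = U x + y *\<^sub>R b" for x y
      using b by (simp add: T_def U_def sum.remove[of Basis b])
    have ins: "insert b (Basis - {b}) = Basis" using b by auto
    have "(\<integral>\<^sup>+x. h x \<partial>lborel) = (\<integral>\<^sup>+x. h (T x) \<partial>(\<Pi>\<^sub>M b\<in>Basis. lborel))"
      by (subst lborel_eq) (simp add: nn_integral_distr T_def)
    also have "\<dots> = (\<integral>\<^sup>+x. \<integral>\<^sup>+y. h (T (x(b := y))) \<partial>lborel \<partial>(\<Pi>\<^sub>M b\<in>Basis - {b}. lborel))"
      using product_nn_integral_insert[of "Basis - {b}" b "\<lambda>x. h (T x)", unfolded ins,
        OF _ _ measurable_compose[OF T_meas that]] by simp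
    finally show ?thesis by (simp only: upd)
  qed
  have "(\<integral>\<^sup>+x. f (x + g x *\<^sub>R b) \<partial>lborel)
      = (\<integral>\<^sup>+x. \<integral>\<^sup>+y. f (U x + (g (U x) + 1 * y) *\<^sub>R b) \<partial>lborel
          \<partial>(\<Pi>\<^sub>M b\<in>Basis - {b}. lborel))"
    by (subst lborel_T) (simp_all add: g_b algebra_simps)
  also have "\<dots> = (\<integral>\<^sup>+x. \<integral>\<^sup>+y. f (U x + y *\<^sub>R b) \<partial>lborel \<partial>(\<Pi>\<^sub>M b\<in>Basis - {b}. lborel))"
  proof (rule nn_integral_cong)
    fix x :: "'a \<Rightarrow> real"
    show "(\<integral>\<^sup>+y. f (U x + (g (U x) + 1 * y) *\<^sub>R b) \<partial>lborel)
        = (\<integral>\<^sup>+y. f (U x + y *\<^sub>R b) \<partial>lborel)"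
      using nn_integral_real_affine[of "\<lambda>y. f (U x + y *\<^sub>R b)" 1 "g (U x)"] by simp
  qed
  also have "\<dots> = (\<integral>\<^sup>+x. f x \<partial>lborel)"
    using lborel_T[OF f] by simp
  finally show ?thesis .
qed

text \<open>The preimage of a box is a box with the same side lengths in another order, and volumes
  of boxes determine Lebesgue measure.\<close>

lemma nn_integral_lborel_permute:
  fixes f :: "real ^ 'n \<Rightarrow> ennreal"
  assumes p: "p permutes UNIV" and [measurable]: "f \<in> borel_measurable borel"
  shows "(\<integral>\<^sup>+x. f (\<chi> i. x $ p i) \<partial>lborel) = (\<integral>\<^sup>+x. f x \<partial>lborel)"
proof -
  let ?h = "\<lambda>x::real ^ 'n. \<chi> i. x $ p i"
  have h[measurable]: "?h \<in> borel_measurable borel"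
    by (intro borel_measurable_continuous_onI continuous_intros)
  have "lborel = distr lborel borel ?h"
  proof (rule lborel_eqI)
    fix l u :: "real ^ 'n"
    assume lu: "\<And>b. b \<in> Basis \<Longrightarrow> l \<bullet> b \<le> u \<bullet> b"
    have lu': "l $ i \<le> u $ i" for i
      using lu[of "axis i 1"] by (simp add: Basis_vec_real inner_axis)
    let ?q = "inv p"
    have q: "?q permutes UNIV" using p by (rule permutes_inv)
    have pq: "p (?q i) = i" "?q (p i) = i" for i
      using p by (simp_all add: permutes_inverses)
    have vim: "?h -` box l u = box (\<chi> i. l $ ?q i) (\<chi> i. u $ ?q i)"
    proof (intro set_eqI)
      fix x
      show "x \<in> ?h -` box l u \<longleftrightarrow> x \<in> box (\<chi> i. l $ ?q i) (\<chi> i. u $ ?q i)"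
        using pq by (auto simp: mem_box_cart) (metis pq)+
    qed
    have "emeasure (distr lborel borel ?h) (box l u) = emeasure lborel (?h -` box l u)"
      by (simp add: emeasure_distr)
    also have "\<dots> = ennreal (\<Prod>b\<in>Basis. ((\<chi> i. u $ ?q i) - (\<chi> i. l $ ?q i)) \<bullet> b)"
      unfolding vim by (subst emeasure_lborel_box) (auto simp: Basis_vec_real inner_axis lu')
    also have "(\<Prod>b\<in>Basis. ((\<chi> i. u $ ?q i) - (\<chi> i. l $ ?q i)) \<bullet> b) = (\<Prod>i\<in>UNIV. (u - l) $ ?q i)"
      by (simp add: Basis_vec_real prod.reindex[OF inj_axis_one] inner_axis)
    also have "\<dots> = (\<Prod>i\<in>UNIV. (u - l) $ i)"
      using prod.permute[OF q, of "\<lambda>i. (u - l) $ i"] by (simp add: o_def)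
    also have "\<dots> = (\<Prod>b\<in>Basis. (u - l) \<bullet> b)"
      by (simp add: Basis_vec_real prod.reindex[OF inj_axis_one] inner_axis)
    finally show "emeasure (distr lborel borel ?h) (box l u) = ennreal (\<Prod>b\<in>Basis. (u - l) \<bullet> b)" .
  qed simp
  then have "(\<integral>\<^sup>+x. f x \<partial>lborel) = (\<integral>\<^sup>+x. f x \<partial>distr lborel borel ?h)"
    by simp
  also have "\<dots> = (\<integral>\<^sup>+x. f (?h x) \<partial>lborel)"
    by (simp add: nn_integral_distr)
  finally show ?thesis by simp
qed

text \<open>Each basis direction is scaled separately; \<open>c b\<close> reads its factor off the
  diagonal, which reduces the claim to coordinatewise scaling of \<open>lborel\<close>.\<close>

lemma nn_integral_lborel_diagonal:
  fixes f :: "real ^ 'n \<Rightarrow> ennreal" and A :: "real ^ 'n ^ 'n"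
  assumes diag: "\<And>i j. i \<noteq> j \<Longrightarrow> A $ i $ j = 0" and det: "det A \<noteq> 0"
    and [measurable]: "f \<in> borel_measurable borel"
  shows "ennreal \<bar>det A\<bar> * (\<integral>\<^sup>+x. f (A *v x) \<partial>lborel) = (\<integral>\<^sup>+x. f x \<partial>lborel)"
proof -
  have detA: "det A = (\<Prod>i\<in>UNIV. A $ i $ i)" using det_diagonal diag by blast
  define c where "c b = b \<bullet> (A *v b)" for b
  have c_axis: "c (axis i 1) = A $ i $ i" for i
    by (simp add: c_def matrix_vector_mult_basis inner_axis' column_def)
  have c0: "c b \<noteq> 0" if "b \<in> Basis" for b
    using that det detA by (auto simp: Basis_vec_real c_axis)
  have A: "A *v x = 0 + (\<Sum>b\<in>Basis. (c b * (x \<bullet> b)) *\<^sub>R b)" for x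
  proof -
    have "(\<Sum>j\<in>UNIV. A $ i $ j * x $ j) = A $ i $ i * x $ i" for i
      by (subst sum.remove[of _ i]) (auto simp: diag intro!: sum.neutral)
    moreover have "(\<Sum>b\<in>Basis. (c b * (x \<bullet> b)) *\<^sub>R b) $ i = A $ i $ i * x $ i" for i
    proof -
      have "((c (axis j 1) * (x \<bullet> axis j 1)) *\<^sub>R axis j 1) $ i = (if j = i then A $ j $ j * x $ j else 0)"
        for j
        by (simp add: c_axis inner_axis) (simp add: axis_def)
      then show ?thesis
        by (simp add: Basis_vec_real sum.reindex[OF inj_axis_one])
    qed
    ultimately show ?thesis
      by (simp add: vec_eq_iff matrix_vector_mult_def)
  qed
  have prod_c: "(\<Prod>b\<in>Basis. \<bar>c b\<bar>) = \<bar>det A\<bar>"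
    by (simp add: detA abs_prod Basis_vec_real prod.reindex[OF inj_axis_one] c_axis)
  have "(\<integral>\<^sup>+x. f x \<partial>lborel) = (\<integral>\<^sup>+x. f x \<partial>density (distr lborel borel ((*v) A)) (\<lambda>_. ennreal \<bar>det A\<bar>))"
    using lborel_affine_euclidean[of c 0, OF c0] by (simp only: A[symmetric] prod_c)
  also have "\<dots> = ennreal \<bar>det A\<bar> * (\<integral>\<^sup>+x. f (A *v x) \<partial>lborel)"
    by (simp add: nn_integral_density nn_integral_distr nn_integral_cmult)
  finally show ?thesis by simp
qed

text \<open>
  The change of variables of the library asks for a well-ordered index type; an arbitrary finite one
  is needed here.
\<close>

lemma nn_integral_lborel_matrix:
  fixes f :: "real ^ 'n \<Rightarrow> ennreal" and A :: "real ^ 'n ^ 'n"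
  assumes "det A \<noteq> 0" "f \<in> borel_measurable borel"
  shows "ennreal \<bar>det A\<bar> * (\<integral>\<^sup>+x. f (A *v x) \<partial>lborel) = (\<integral>\<^sup>+x. f x \<partial>lborel)"
  using assms
proof (induction A arbitrary: f rule: induct_matrix_elementary)
  \<comment> \<open>The hypothesis for \<open>B\<close> is applied to
    \<open>\<lambda>x. f (A *v x)\<close>, which is why the induction generalises
    \<open>f\<close>.\<close>
  case (1 A B)
  note [measurable] = 1(4)
  have "(\<integral>\<^sup>+x. f x \<partial>lborel) = ennreal \<bar>det A\<bar> * (\<integral>\<^sup>+x. f (A *v x) \<partial>lborel)"
    using 1 by (simp add: det_mul)
  also have "(\<integral>\<^sup>+x. f (A *v x) \<partial>lborel) = ennreal \<bar>det B\<bar> * (\<integral>\<^sup>+x. f (A *v (B *v x)) \<partial>lborel)"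
    using 1(2)[of "\<lambda>x. f (A *v x)"] 1(3) by (simp add: det_mul)
  finally show ?case
    by (simp add: det_mul abs_mult ennreal_mult matrix_vector_mul_assoc mult.assoc)
next
  case (2 A i)
  then show ?case using det_zero_row(2) by metis
next
  case (3 A)
  then show ?case by (intro nn_integral_lborel_diagonal) auto
next
  case (4 m n)
  let ?p = "Transposition.transpose m n"
  let ?A = "(\<chi> i j. mat 1 $ i $ ?p j) :: real ^ 'n ^ 'n"
  have p: "?p permutes UNIV" by (simp add: permutes_swap_id)
  have "\<bar>det ?A\<bar> = 1"
    using 4(1) by (simp add: det_permute_columns[OF p] sign_swap_id)
  moreover have "?A *v x = (\<chi> i. x $ ?p i)" for x
  proof -
    have "(\<Sum>j\<in>UNIV. mat 1 $ i $ ?p j * x $ j) = (\<Sum>j\<in>UNIV. if j = ?p i then x $ j else 0)" for i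
      by (rule sum.cong) (auto simp: mat_def)
    then show ?thesis by (simp add: matrix_vector_mult_def vec_eq_iff)
  qed
  ultimately show ?case
    using nn_integral_lborel_permute[OF p 4(3)] by simp
next
  case (5 m n c)
  let ?A = "(\<chi> i j. if i = m \<and> j = n then c else of_bool (i = j)) :: real ^ 'n ^ 'n"
  have A: "?A *v x = x + (c * x $ n) *\<^sub>R axis m 1" for x
  proof -
    have "(\<Sum>j\<in>UNIV. (if i = m \<and> j = n then c else of_bool (i = j)) * x $ j)
        = x $ i + (if i = m then c * x $ n else 0)" for i
    proof -
      have "(\<Sum>j\<in>UNIV. (if i = m \<and> j = n then c else of_bool (i = j)) * x $ j)
          = (\<Sum>j\<in>UNIV. (if j = i then x $ j else 0) + (if j = n then if i = m then c * x $ j else 0 else 0))"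
        using 5(1) by (intro sum.cong) auto
      then show ?thesis by (simp add: sum.distrib)
    qed
    then show ?thesis by (simp add: matrix_vector_mult_def vec_eq_iff axis_def)
  qed
  \<comment> \<open>The shear is the identity after adding \<open>c\<close> times row
    \<open>n\<close> to row \<open>m\<close>, an operation that preserves the determinant.\<close>
  have "?A = (\<chi> k. if k = m then row m (mat 1) + c *s row n (mat 1) else row k (mat 1))"
    using 5(1) by (auto simp: vec_eq_iff row_def mat_def)
  then have "det ?A = 1"
    using det_row_operation[OF 5(1), of "mat 1 :: real ^ 'n ^ 'n" c] by simp
  moreover have "(\<integral>\<^sup>+x. f (x + (c * x $ n) *\<^sub>R axis m 1) \<partial>lborel) = (\<integral>\<^sup>+x. f x \<partial>lborel)"
  proof (rule nn_integral_lborel_shear)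
    show "(\<lambda>x. c * x $ n) \<in> borel_measurable borel"
      by (intro borel_measurable_continuous_onI continuous_intros)
    show "f \<in> borel_measurable borel" by (rule 5(3))
    show "axis m 1 \<in> (Basis :: (real ^ 'n) set)" by (auto simp: Basis_vec_real)
    \<comment> \<open>Moving along axis \<open>m\<close> does not touch coordinate \<open>n\<close>,
      because \<open>m \<noteq> n\<close>.\<close>
    show "c * (x + s *\<^sub>R axis m 1) $ n = c * x $ n" for x :: "real ^ 'n" and s
      using 5(1) by (simp add: axis_def)
  qed
  ultimately show ?case unfolding A by simp
qed

section \<open>Symmetric positive definite matrices and Gaussian integrals\<close>

lemma inner_matrix_vector_left:
  fixes A :: "real ^ 'n ^ 'm"
  shows "(A *v x) \<bullet> y = x \<bullet> (transpose A *v y)"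
  by (metis dot_lmul_matrix inner_commute transpose_matrix_vector transpose_transpose)

lemma sym_pos_def_inner_commute:
  "sym_pos_def A \<Longrightarrow> x \<bullet> (A *v y) = y \<bullet> (A *v x)"
  unfolding sym_pos_def_def by (metis inner_matrix_vector_left inner_commute)

lemma sym_pos_def_inner_nonneg: "sym_pos_def A \<Longrightarrow> 0 \<le> x \<bullet> (A *v x)"
  unfolding sym_pos_def_def by (cases "x = 0") (auto intro: less_imp_le)

text \<open>Gram-Schmidt for the inner product \<open>x \<bullet> (A *v y)\<close>, one index at a
  time. The vectors \<open>A *v b i\<close> found so far span a proper subspace; a nonzero vector
  orthogonal to it is \<open>A\<close>-orthogonal to every earlier \<open>b i\<close> and only has
  to be normalised.\<close>

lemma sym_pos_def_orthonormal_family: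
  fixes A :: "real ^ 'n ^ 'n"
  assumes A: "sym_pos_def A"
  shows "\<exists>b :: 'n \<Rightarrow> real ^ 'n. \<forall>i\<in>S. \<forall>j\<in>S. b i \<bullet> (A *v b j) = of_bool (i = j)"
proof (induction S rule: finite_induct[OF finite])
  case 1
  then show ?case by simp
next
  case (2 k S)
  then obtain b :: "'n \<Rightarrow> real ^ 'n"
    where b: "\<And>i j. i \<in> S \<Longrightarrow> j \<in> S \<Longrightarrow> b i \<bullet> (A *v b j) = of_bool (i = j)"
    by blast
  let ?U = "(\<lambda>i. A *v b i) ` S"
  have "dim ?U \<le> card S"
    using dim_le_card'[of ?U] card_image_le[of S "\<lambda>i. A *v b i"] by simp
  also have "\<dots> < CARD('n)"
    using 2(2) by (intro psubset_card_mono) auto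
  finally obtain x where x: "x \<noteq> 0" "\<And>y. y \<in> span ?U \<Longrightarrow> orthogonal x y"
    using orthogonal_to_subspace_exists[of ?U] by auto
  define r where "r = x \<bullet> (A *v x)"
  have r: "r > 0" using A x(1) by (simp add: r_def sym_pos_def_def)
  define v where "v = (1 / sqrt r) *\<^sub>R x"
  have vv: "v \<bullet> (A *v v) = 1"
    using r by (simp add: v_def matrix_vector_mult_scaleR r_def[symmetric] real_sqrt_mult[symmetric]
        power2_eq_square[symmetric] field_simps)
  have vb: "v \<bullet> (A *v b i) = 0" "b i \<bullet> (A *v v) = 0" if "i \<in> S" for i
  proof -
    show "v \<bullet> (A *v b i) = 0"
      using x(2)[OF span_base, of "A *v b i"] that by (simp add: v_def orthogonal_def)
    then show "b i \<bullet> (A *v v) = 0" using sym_pos_def_inner_commute[OF A] by metis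
  qed
  have "\<forall>i\<in>insert k S. \<forall>j\<in>insert k S. (b(k := v)) i \<bullet> (A *v (b(k := v)) j) = of_bool (i = j)"
    using 2(2) b vb vv by auto
  then show ?case by blast
qed

text \<open>The columns of \<open>C\<close> are an \<open>A\<close>-orthonormal basis and
  \<open>transpose C ** A ** C\<close> is their Gram matrix. This \<open>C\<close> plays the part of
  an inverse square root of \<open>A\<close>.\<close>

lemma sym_pos_def_diagonalize:
  fixes A :: "real ^ 'n ^ 'n"
  assumes A: "sym_pos_def A"
  obtains C :: "real ^ 'n ^ 'n" where "transpose C ** A ** C = mat 1" "det A * (det C)\<^sup>2 = 1"
proof -
  obtain b :: "'n \<Rightarrow> real ^ 'n" where b: "\<And>i j. b i \<bullet> (A *v b j) = of_bool (i = j)"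
    using sym_pos_def_orthonormal_family[OF A, of UNIV] by blast
  define C :: "real ^ 'n ^ 'n" where "C = (\<chi> i j. b j $ i)"
  have Cb: "C *v axis j 1 = b j" for j
    by (simp add: C_def matrix_vector_mult_basis column_def)
  have "(transpose C ** A ** C) $ i $ j = mat 1 $ i $ j" for i j
  proof -
    have "(transpose C ** A ** C) $ i $ j = axis i 1 \<bullet> ((transpose C ** A ** C) *v axis j 1)"
      by (simp add: matrix_vector_mult_basis column_def inner_axis')
    also have "\<dots> = (C *v axis i 1) \<bullet> (A *v (C *v axis j 1))"
      by (simp add: inner_matrix_vector_left matrix_vector_mul_assoc[symmetric])
    finally show ?thesis by (simp add: Cb b mat_def)
  qed
  then have C: "transpose C ** A ** C = mat 1"
    by (simp add: vec_eq_iff)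
  then have "det (transpose C ** A ** C) = det (mat 1 :: real ^ 'n ^ 'n)" by simp
  then have "det A * (det C)\<^sup>2 = 1"
    by (simp add: det_mul power2_eq_square mult_ac)
  with C show ?thesis by (rule that)
qed

lemma sym_pos_def_det_pos:
  fixes A :: "real ^ 'n ^ 'n"
  assumes A: "sym_pos_def A"
  shows "det A > 0"
proof -
  obtain C :: "real ^ 'n ^ 'n" where C: "det A * (det C)\<^sup>2 = 1"
    using sym_pos_def_diagonalize[OF A] by blast
  then have "(det C)\<^sup>2 > 0" by (cases "det C = 0") auto
  then show ?thesis using C zero_less_mult_pos2[of "det A" "(det C)\<^sup>2"] by simp
qed

lemma sym_pos_def_matrix_inv:
  fixes A :: "real ^ 'n ^ 'n"
  assumes "sym_pos_def A"
  shows "A ** matrix_inv A = mat 1" "matrix_inv A ** A = mat 1"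
proof -
  have "\<exists>B. A ** B = mat 1 \<and> B ** A = mat 1"
    using sym_pos_def_det_pos[OF assms] invertible_det_nz[of A] by (simp add: invertible_def)
  from someI_ex[OF this] show "A ** matrix_inv A = mat 1" "matrix_inv A ** A = mat 1"
    by (simp_all add: matrix_inv_def)
qed

text \<open>\<open>M\<close> may have a kernel, so the added term is only nonnegative; strictness
  comes from \<open>A\<close>. Iterated, this keeps every \<open>P + Vmat\<close> positive
  definite.\<close>

lemma sym_pos_def_add_congruence:
  fixes A :: "real ^ 'n ^ 'n" and W :: "real ^ 'm ^ 'm"
  assumes A: "sym_pos_def A" and W: "sym_pos_def W"
  shows "sym_pos_def (A + transpose M ** W ** M)"
proof -
  have add: "transpose (X + Y) = transpose X + transpose Y" for X Y :: "real ^ 'n ^ 'n"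
    by (simp add: transpose_def vec_eq_iff)
  have "transpose (A + transpose M ** W ** M) = A + transpose M ** W ** M"
    using A W by (simp add: add sym_pos_def_def matrix_transpose_mul matrix_mul_assoc)
  moreover have "0 < x \<bullet> ((A + transpose M ** W ** M) *v x)" if "x \<noteq> 0" for x
  proof -
    have "x \<bullet> ((transpose M ** W ** M) *v x) = (M *v x) \<bullet> (W *v (M *v x))"
      by (simp add: inner_matrix_vector_left matrix_vector_mul_assoc[symmetric])
    then have "0 \<le> x \<bullet> ((transpose M ** W ** M) *v x)"
      using sym_pos_def_inner_nonneg[OF W] by simp
    moreover have "0 < x \<bullet> (A *v x)" using A that by (simp add: sym_pos_def_def)
    ultimately show ?thesis by (simp add: matrix_vector_mult_add_rdistrib inner_add_right)
  qed
  ultimately show ?thesis by (simp add: sym_pos_def_def)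
qed

section \<open>Gaussian integrals\<close>

lemma nn_integral_gaussian_real:
  assumes c: "c > 0"
  shows "(\<integral>\<^sup>+x. ennreal (exp (- (x\<^sup>2 / (2 * c\<^sup>2)))) \<partial>lborel) = ennreal (sqrt (2 * pi * c\<^sup>2))"
proof -
  have "(\<integral>\<^sup>+x. ennreal (exp (- (x\<^sup>2 / (2 * c\<^sup>2)))) \<partial>lborel)
      = (\<integral>\<^sup>+x. ennreal (sqrt (2 * pi * c\<^sup>2)) * ennreal (normal_density 0 c x) \<partial>lborel)"
    using c by (intro nn_integral_cong) (simp add: normal_density_def ennreal_mult[symmetric])
  also have "\<dots> = ennreal (sqrt (2 * pi * c\<^sup>2)) * (\<integral>\<^sup>+x. ennreal (normal_density 0 c x) \<partial>lborel)"
    by (intro nn_integral_cmult) simp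
  also have "(\<integral>\<^sup>+x. ennreal (normal_density 0 c x) \<partial>lborel) = 1"
    using c by (subst nn_integral_eq_integral) (auto intro!: integrable_normal_density)
  finally show ?thesis by simp
qed

lemma nn_integral_gaussian_standard:
  assumes c: "c > 0"
  shows "(\<integral>\<^sup>+x. ennreal (exp (- (((x :: real ^ 'n) \<bullet> x) / (2 * c\<^sup>2)))) \<partial>lborel)
    = ennreal (sqrt (2 * pi * c\<^sup>2) ^ CARD('n))"
proof -
  have "(\<integral>\<^sup>+x. ennreal (exp (- (((x :: real ^ 'n) \<bullet> x) / (2 * c\<^sup>2)))) \<partial>lborel)
      = (\<integral>\<^sup>+x. (\<Prod>b\<in>(Basis :: (real ^ 'n) set). ennreal (exp (- ((x \<bullet> b)\<^sup>2 / (2 * c\<^sup>2))))) \<partial>lborel)"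
  proof (rule nn_integral_cong)
    fix x :: "real ^ 'n"
    have "- ((x \<bullet> x) / (2 * c\<^sup>2)) = (\<Sum>b\<in>Basis. - ((x \<bullet> b)\<^sup>2 / (2 * c\<^sup>2)))"
      by (subst euclidean_inner)
        (simp add: power2_eq_square sum_negf sum_divide_distrib)
    then show "ennreal (exp (- ((x \<bullet> x) / (2 * c\<^sup>2))))
        = (\<Prod>b\<in>Basis. ennreal (exp (- ((x \<bullet> b)\<^sup>2 / (2 * c\<^sup>2)))))"
      by (simp add: exp_sum prod_ennreal)
  qed
  also have "\<dots> = (\<Prod>b\<in>(Basis :: (real ^ 'n) set). ennreal (sqrt (2 * pi * c\<^sup>2)))"
    by (subst nn_integral_lborel_prod) (simp_all add: nn_integral_gaussian_real[OF c] del: prod_constant)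
  also have "\<dots> = ennreal (sqrt (2 * pi * c\<^sup>2) ^ CARD('n))"
    by (simp add: ennreal_power)
  finally show ?thesis .
qed

text \<open>Substituting \<open>x = C *v z\<close>, with \<open>C\<close> the congruence taking
  \<open>A\<close> to the identity, leaves the standard Gaussian and the Jacobian
  \<open>1 / sqrt (det A)\<close>.\<close>

lemma nn_integral_gaussian:
  fixes A :: "real ^ 'n ^ 'n"
  assumes A: "sym_pos_def A" and c: "c > 0"
  shows "(\<integral>\<^sup>+x. ennreal (exp (- ((x \<bullet> (A *v x)) / (2 * c\<^sup>2)))) \<partial>lborel)
    = ennreal (sqrt (2 * pi * c\<^sup>2) ^ CARD('n) / sqrt (det A))"
proof -
  obtain C :: "real ^ 'n ^ 'n"
    where C: "transpose C ** A ** C = mat 1" and AC: "det A * (det C)\<^sup>2 = 1"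
    using sym_pos_def_diagonalize[OF A] by blast
  have det0: "det C \<noteq> 0" using AC by auto
  have "(\<bar>det C\<bar> * sqrt (det A)) = sqrt (det A * (det C)\<^sup>2)"
    by (simp add: real_sqrt_mult)
  then have "\<bar>det C\<bar> * sqrt (det A) = 1" by (simp add: AC)
  then have absC: "\<bar>det C\<bar> = 1 / sqrt (det A)"
    by (metis mult_zero_right nonzero_eq_divide_eq zero_neq_one)
  have quad: "(C *v z) \<bullet> (A *v (C *v z)) = z \<bullet> z" for z
    using C by (metis inner_matrix_vector_left matrix_vector_mul_assoc matrix_vector_mul_lid)
  have meas: "(\<lambda>x. ennreal (exp (- ((x \<bullet> (A *v x)) / (2 * c\<^sup>2))))) \<in> borel_measurable borel"
    by measurable
  have "(\<integral>\<^sup>+x. ennreal (exp (- ((x \<bullet> (A *v x)) / (2 * c\<^sup>2)))) \<partial>lborel)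
      = ennreal \<bar>det C\<bar> * (\<integral>\<^sup>+z. ennreal (exp (- (((z :: real ^ 'n) \<bullet> z) / (2 * c\<^sup>2)))) \<partial>lborel)"
    using nn_integral_lborel_matrix[OF det0 meas] by (simp add: quad)
  then show ?thesis
    by (simp add: nn_integral_gaussian_standard[OF c] absC ennreal_mult'[symmetric] sym_pos_def_det_pos[OF A, THEN less_imp_le])
qed

text \<open>Completing the square: the exponent peaks at \<open>l = x\<close>, and translating by
  \<open>x\<close> leaves a centred Gaussian times the exponential of the peak value.\<close>

lemma nn_integral_gaussian_tilted:
  fixes A :: "real ^ 'n ^ 'n"
  assumes A: "sym_pos_def A" and c: "c > 0"
  shows "(\<integral>\<^sup>+l. ennreal (exp ((l \<bullet> (A *v x) - l \<bullet> (A *v l) / 2) / c\<^sup>2)) \<partial>lborel)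
    = ennreal (exp ((x \<bullet> (A *v x)) / (2 * c\<^sup>2)) * (sqrt (2 * pi * c\<^sup>2) ^ CARD('n) / sqrt (det A)))"
proof -
  have square: "((x + l) \<bullet> (A *v x) - (x + l) \<bullet> (A *v (x + l)) / 2) / c\<^sup>2
      = (x \<bullet> (A *v x)) / (2 * c\<^sup>2) + - ((l \<bullet> (A *v l)) / (2 * c\<^sup>2))" for l
    using sym_pos_def_inner_commute[OF A, of x l] c
    by (simp add: matrix_vector_right_distrib inner_add_left inner_add_right field_simps)
  have "(\<integral>\<^sup>+l. ennreal (exp ((l \<bullet> (A *v x) - l \<bullet> (A *v l) / 2) / c\<^sup>2)) \<partial>lborel)
      = (\<integral>\<^sup>+l. ennreal (exp ((l \<bullet> (A *v x) - l \<bullet> (A *v l) / 2) / c\<^sup>2)) \<partial>distr lborel borel ((+) x))"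
    by (simp only: lborel_distr_plus)
  also have "\<dots> = (\<integral>\<^sup>+l. ennreal (exp ((x \<bullet> (A *v x)) / (2 * c\<^sup>2)))
      * ennreal (exp (- ((l \<bullet> (A *v l)) / (2 * c\<^sup>2)))) \<partial>lborel)"
    by (subst nn_integral_distr) (simp_all only: square exp_add, simp_all add: ennreal_mult)
  also have "\<dots> = ennreal (exp ((x \<bullet> (A *v x)) / (2 * c\<^sup>2)))
      * (\<integral>\<^sup>+l. ennreal (exp (- ((l \<bullet> (A *v l)) / (2 * c\<^sup>2)))) \<partial>lborel)"
    by (rule nn_integral_cmult) measurable
  finally show ?thesis
    by (simp add: nn_integral_gaussian[OF A c] ennreal_mult'[symmetric])
qed

section \<open>Sub-Gaussian tilting and the maximal inequality\<close>

text \<open>Since \<open>Z * exp (- r)\<close> is \<open>F\<close>-measurable, the other factor may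
  be replaced under the integral by its conditional expectation, whose bound \<open>exp r\<close>
  cancels \<open>exp (- r)\<close>.\<close>

lemma (in sigma_finite_subalgebra) nn_integral_exp_tilt_const:
  fixes w :: "'a \<Rightarrow> 'b::euclidean_space"
  assumes w[measurable]: "w \<in> borel_measurable M"
    and bound: "AE \<omega> in M. nn_cond_exp M F (\<lambda>\<omega>. ennreal (exp (\<eta> \<bullet> w \<omega>))) \<omega> \<le> ennreal (exp r)"
    and Z[measurable]: "Z \<in> borel_measurable F"
  shows "(\<integral>\<^sup>+\<omega>. Z \<omega> * ennreal (exp (\<eta> \<bullet> w \<omega> - r)) \<partial>M) \<le> (\<integral>\<^sup>+\<omega>. Z \<omega> \<partial>M)"
proof -
  have "(\<integral>\<^sup>+\<omega>. Z \<omega> * ennreal (exp (\<eta> \<bullet> w \<omega> - r)) \<partial>M)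
      = (\<integral>\<^sup>+\<omega>. (Z \<omega> * ennreal (exp (- r))) * ennreal (exp (\<eta> \<bullet> w \<omega>)) \<partial>M)"
    by (intro nn_integral_cong)
      (simp add: mult.assoc ennreal_mult[symmetric] exp_add[symmetric] add.commute)
  also have "\<dots> = (\<integral>\<^sup>+\<omega>. (Z \<omega> * ennreal (exp (- r)))
      * nn_cond_exp M F (\<lambda>\<omega>. ennreal (exp (\<eta> \<bullet> w \<omega>))) \<omega> \<partial>M)"
    by (rule nn_cond_exp_intg[symmetric]) measurable
  also have "\<dots> \<le> (\<integral>\<^sup>+\<omega>. (Z \<omega> * ennreal (exp (- r))) * ennreal (exp r) \<partial>M)"
    by (rule nn_integral_mono_AE, use bound in eventually_elim) (rule mult_left_mono, simp_all)
  also have "\<dots> = (\<integral>\<^sup>+\<omega>. Z \<omega> \<partial>M)"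
    by (simp add: mult.assoc ennreal_mult[symmetric] exp_add[symmetric])
  finally show ?thesis .
qed

text \<open>On each level set of \<open>s\<close> the direction is constant, and the
  \<open>F\<close>-measurable indicator of that set is absorbed into \<open>Z\<close>. There are
  finitely many such sets to sum over.\<close>

lemma (in sigma_finite_subalgebra) nn_integral_exp_tilt_simple:
  fixes w :: "'a \<Rightarrow> 'b::euclidean_space"
  assumes w[measurable]: "w \<in> borel_measurable M"
    and bound: "\<And>\<eta>. AE \<omega> in M. nn_cond_exp M F (\<lambda>\<omega>. ennreal (exp (\<eta> \<bullet> w \<omega>))) \<omega> \<le> ennreal (exp (q \<eta>))"
    and Z[measurable]: "Z \<in> borel_measurable F"
    and s: "simple_function F s"
  shows "(\<integral>\<^sup>+\<omega>. Z \<omega> * ennreal (exp (s \<omega> \<bullet> w \<omega> - q (s \<omega>))) \<partial>M) \<le> (\<integral>\<^sup>+\<omega>. Z \<omega> \<partial>M)"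
proof -
  have sp: "space F = space M" using subalg by (simp add: subalgebra_def)
  let ?V = "s ` space M"
  let ?B = "\<lambda>v. s -` {v} \<inter> space M"
  have V: "finite ?V" using simple_functionD(1)[OF s] sp by simp
  have B[measurable]: "?B v \<in> sets F" for v using simple_functionD(2)[OF s] sp by simp
  have BM[measurable]: "?B v \<in> sets M" for v
    using B subalg by (auto simp: subalgebra_def)
  have ZM[measurable]: "Z \<in> borel_measurable M"
    using measurable_from_subalg[OF subalg Z] .
  \<comment> \<open>Used twice: with \<open>h\<close> the tilt to break the integrand apart, and
    with \<open>h = 1\<close> to reassemble \<open>Z\<close>.\<close>
  have split: "(\<Sum>v\<in>?V. (Z \<omega> * indicator (?B v) \<omega>) * h v) = Z \<omega> * h (s \<omega>)"
    if "\<omega> \<in> space M" for \<omega> and h :: "'b \<Rightarrow> ennreal"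
  proof -
    have "(\<Sum>v\<in>?V. (Z \<omega> * indicator (?B v) \<omega>) * h v) = (\<Sum>v\<in>?V. if v = s \<omega> then Z \<omega> * h v else 0)"
      using that by (intro sum.cong) (auto simp: indicator_def)
    then show ?thesis using V that by simp
  qed
  have "(\<integral>\<^sup>+\<omega>. Z \<omega> * ennreal (exp (s \<omega> \<bullet> w \<omega> - q (s \<omega>))) \<partial>M)
      = (\<integral>\<^sup>+\<omega>. (\<Sum>v\<in>?V. (Z \<omega> * indicator (?B v) \<omega>) * ennreal (exp (v \<bullet> w \<omega> - q v))) \<partial>M)"
    by (intro nn_integral_cong) (simp add: split)
  also have "\<dots> = (\<Sum>v\<in>?V. \<integral>\<^sup>+\<omega>. (Z \<omega> * indicator (?B v) \<omega>) * ennreal (exp (v \<bullet> w \<omega> - q v)) \<partial>M)"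
    by (intro nn_integral_sum) measurable
  also have "\<dots> \<le> (\<Sum>v\<in>?V. \<integral>\<^sup>+\<omega>. Z \<omega> * indicator (?B v) \<omega> \<partial>M)"
    by (intro sum_mono nn_integral_exp_tilt_const w bound) measurable
  also have "\<dots> = (\<integral>\<^sup>+\<omega>. (\<Sum>v\<in>?V. (Z \<omega> * indicator (?B v) \<omega>) * 1) \<partial>M)"
    by (subst nn_integral_sum) simp_all
  also have "\<dots> = (\<integral>\<^sup>+\<omega>. Z \<omega> \<partial>M)"
    by (intro nn_integral_cong) (subst split, simp_all)
  finally show ?thesis .
qed

text \<open>
  The hypothesis holds for each deterministic direction outside a null set depending on it; random
  directions are reached through simple functions and Fatou's lemma.
\<close>

lemma (in sigma_finite_subalgebra) nn_integral_exp_tilt: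
  fixes w :: "'a \<Rightarrow> 'b::euclidean_space"
  assumes w[measurable]: "w \<in> borel_measurable M"
    and bound: "\<And>\<eta>. AE \<omega> in M. nn_cond_exp M F (\<lambda>\<omega>. ennreal (exp (\<eta> \<bullet> w \<omega>))) \<omega> \<le> ennreal (exp (q \<eta>))"
    and q: "continuous_on UNIV q"
    and Z[measurable]: "Z \<in> borel_measurable F" and Z_nonneg: "\<And>\<omega>. 0 \<le> Z \<omega>"
    and \<nu>: "\<nu> \<in> borel_measurable F"
  shows "(\<integral>\<^sup>+\<omega>. ennreal (Z \<omega> * exp (\<nu> \<omega> \<bullet> w \<omega> - q (\<nu> \<omega>))) \<partial>M) \<le> (\<integral>\<^sup>+\<omega>. ennreal (Z \<omega>) \<partial>M)"
proof -
  have sp: "space F = space M" using subalg by (simp add: subalgebra_def)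
  have ZM[measurable]: "Z \<in> borel_measurable M"
    using measurable_from_subalg[OF subalg Z] .
  have [measurable]: "q \<in> borel_measurable borel"
    using q by (rule borel_measurable_continuous_onI)
  obtain s where s: "\<And>i. simple_function F (s i)"
    and lim: "\<And>\<omega>. \<omega> \<in> space M \<Longrightarrow> (\<lambda>i. s i \<omega>) \<longlonglongrightarrow> \<nu> \<omega>"
    using borel_measurable_implies_sequence_metric[OF \<nu>, of 0] sp by metis
  have [measurable]: "s i \<in> borel_measurable M" for i
    using measurable_from_subalg[OF subalg borel_measurable_simple_function[OF s]] .
  let ?X = "\<lambda>i \<omega>. ennreal (Z \<omega> * exp (s i \<omega> \<bullet> w \<omega> - q (s i \<omega>)))"
  have le: "(\<integral>\<^sup>+\<omega>. ?X i \<omega> \<partial>M) \<le> (\<integral>\<^sup>+\<omega>. ennreal (Z \<omega>) \<partial>M)" for i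
    using nn_integral_exp_tilt_simple[where Z="\<lambda>\<omega>. ennreal (Z \<omega>)", OF w bound _ s[of i]]
    by (simp add: ennreal_mult Z_nonneg)
  have "(\<integral>\<^sup>+\<omega>. ennreal (Z \<omega> * exp (\<nu> \<omega> \<bullet> w \<omega> - q (\<nu> \<omega>))) \<partial>M)
      = (\<integral>\<^sup>+\<omega>. liminf (\<lambda>i. ?X i \<omega>) \<partial>M)"
  proof (rule nn_integral_cong)
    fix \<omega> assume \<omega>: "\<omega> \<in> space M"
    have "(\<lambda>i. q (s i \<omega>)) \<longlonglongrightarrow> q (\<nu> \<omega>)"
      using q lim[OF \<omega>] by (rule continuous_on_tendsto_compose) auto
    then have "(\<lambda>i. ?X i \<omega>) \<longlonglongrightarrow> ennreal (Z \<omega> * exp (\<nu> \<omega> \<bullet> w \<omega> - q (\<nu> \<omega>)))"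
      using lim[OF \<omega>] by (intro tendsto_intros tendsto_ennrealI)
    then show "ennreal (Z \<omega> * exp (\<nu> \<omega> \<bullet> w \<omega> - q (\<nu> \<omega>))) = liminf (\<lambda>i. ?X i \<omega>)"
      by (simp add: lim_imp_Liminf)
  qed
  also have "\<dots> \<le> liminf (\<lambda>i. \<integral>\<^sup>+\<omega>. ?X i \<omega> \<partial>M)"
    by (intro nn_integral_liminf) measurable
  also have "\<dots> \<le> liminf (\<lambda>i::nat. \<integral>\<^sup>+\<omega>. ennreal (Z \<omega>) \<partial>M)"
    by (intro Liminf_mono always_eventually allI le)
  also have "\<dots> = (\<integral>\<^sup>+\<omega>. ennreal (Z \<omega>) \<partial>M)"
    by (simp add: Liminf_const)
  finally show ?thesis .
qed

section \<open>Maximal inequality for nonnegative supermartingales\<close>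

text \<open>
  Only \<open>F t\<close> with \<open>t < K\<close> enters: at the horizon, \<^const>\<open>info_alg\<close> contains a regressor that need not be
  measurable.
\<close>

lemma nn_supermartingale_maximal:
  fixes N :: "nat \<Rightarrow> 'a \<Rightarrow> ennreal" and a :: ennreal
  assumes subalg: "\<And>t. t < K \<Longrightarrow> subalgebra M (F t)"
    and mono: "\<And>s t. s \<le> t \<Longrightarrow> t < K \<Longrightarrow> sets (F s) \<subseteq> sets (F t)"
    and adapted: "\<And>t. t < K \<Longrightarrow> N t \<in> borel_measurable (F t)"
    and N_K: "N K \<in> borel_measurable M"
    and super: "\<And>t A. t < K \<Longrightarrow> A \<in> sets (F t)
      \<Longrightarrow> (\<integral>\<^sup>+\<omega>\<in>A. N (Suc t) \<omega> \<partial>M) \<le> (\<integral>\<^sup>+\<omega>\<in>A. N t \<omega> \<partial>M)"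
  shows "a * emeasure M {\<omega> \<in> space M. \<exists>t\<le>K. a < N t \<omega>} \<le> (\<integral>\<^sup>+\<omega>. N 0 \<omega> \<partial>M)"
proof -
  have NM[measurable]: "N t \<in> borel_measurable M" if "t \<le> K" for t
    using that N_K measurable_from_subalg[OF subalg adapted] by (cases "t = K") auto
  \<comment> \<open>\<open>G t\<close> looks only at times strictly before \<open>t\<close>, so for
    \<open>t < K\<close> the set \<open>G (Suc t)\<close> is decided by time \<open>t\<close> and
    lies in \<open>F t\<close>.\<close>
  define G where "G t = {\<omega> \<in> space M. \<forall>s<t. N s \<omega> \<le> a}" for t
  define B where "B t = {\<omega> \<in> space M. \<exists>s<t. a < N s \<omega>}" for t
  have GM[measurable]: "G t \<in> sets M" if "t \<le> Suc K" for t
  proof -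
    have "G t = space M \<inter> (\<Inter>s\<in>{..<t}. {\<omega> \<in> space M. N s \<omega> \<le> a})" by (auto simp: G_def)
    also have "\<dots> \<in> sets M"
      using that by (cases "t = 0") (auto intro!: sets.Int sets.finite_INT borel_measurable_le)
    finally show ?thesis .
  qed
  have GF: "G (Suc t) \<in> sets (F t)" if t: "t < K" for t
  proof -
    have sp: "space (F t) = space M" using subalg[OF t] by (simp add: subalgebra_def)
    have "{\<omega> \<in> space M. N s \<omega> \<le> a} \<in> sets (F t)" if "s \<le> t" for s
    proof -
      have "s < K" using that t by simp
      then have "{\<omega> \<in> space (F s). N s \<omega> \<le> a} \<in> sets (F s)"
        using adapted by measurable
      moreover have "space (F s) = space M"
        using subalg[OF \<open>s < K\<close>] by (simp add: subalgebra_def)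
      ultimately show ?thesis using mono[OF that t] by auto
    qed
    then have "(\<Inter>s\<in>{..t}. {\<omega> \<in> space M. N s \<omega> \<le> a}) \<in> sets (F t)"
      by (intro sets.finite_INT) auto
    also have "(\<Inter>s\<in>{..t}. {\<omega> \<in> space M. N s \<omega> \<le> a}) = G (Suc t)"
      by (auto simp: G_def less_Suc_eq_le)
    finally show ?thesis .
  qed
  have B_eq: "B t = space M - G t" for t by (auto simp: B_def G_def not_le)
  have BM[measurable]: "B t \<in> sets M" if "t \<le> Suc K" for t
    using GM[OF that] by (simp add: B_eq)
  \<comment> \<open>The process is frozen at \<open>a\<close> once it exceeds \<open>a\<close>: a
    path first exceeding at time \<open>t\<close> trades \<open>N t\<close> for the smaller
    \<open>a\<close>.\<close>
  have stop: "(\<integral>\<^sup>+\<omega>. a * indicator (B (Suc t)) \<omega> + N t \<omega> * indicator (G (Suc t)) \<omega> \<partial>M)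
      \<le> (\<integral>\<^sup>+\<omega>. a * indicator (B t) \<omega> + N t \<omega> * indicator (G t) \<omega> \<partial>M)" for t
  proof (rule nn_integral_mono)
    fix \<omega> assume "\<omega> \<in> space M"
    then show "a * indicator (B (Suc t)) \<omega> + N t \<omega> * indicator (G (Suc t)) \<omega>
        \<le> a * indicator (B t) \<omega> + N t \<omega> * indicator (G t) \<omega>"
      by (auto simp: B_eq G_def less_Suc_eq indicator_def not_le)
  qed
  have inv: "(\<integral>\<^sup>+\<omega>. a * indicator (B t) \<omega> + N t \<omega> * indicator (G t) \<omega> \<partial>M) \<le> (\<integral>\<^sup>+\<omega>. N 0 \<omega> \<partial>M)"
    if "t \<le> K" for t
    using that
  proof (induction t)
    case 0
    show ?case
      by (intro nn_integral_mono) (auto simp: B_def G_def indicator_def)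
  next
    case (Suc t)
    then have t: "t < K" by simp
    note [measurable] = GM[of "Suc t"] BM[of "Suc t"] NM[of t] NM[of "Suc t"]
    have "(\<integral>\<^sup>+\<omega>. a * indicator (B (Suc t)) \<omega> + N (Suc t) \<omega> * indicator (G (Suc t)) \<omega> \<partial>M)
        = (\<integral>\<^sup>+\<omega>. a * indicator (B (Suc t)) \<omega> \<partial>M) + (\<integral>\<^sup>+\<omega>\<in>G (Suc t). N (Suc t) \<omega> \<partial>M)"
      using t by (intro nn_integral_add) auto
    also have "\<dots> \<le> (\<integral>\<^sup>+\<omega>. a * indicator (B (Suc t)) \<omega> \<partial>M) + (\<integral>\<^sup>+\<omega>\<in>G (Suc t). N t \<omega> \<partial>M)"
      by (intro add_left_mono super t GF)
    also have "\<dots> = (\<integral>\<^sup>+\<omega>. a * indicator (B (Suc t)) \<omega> + N t \<omega> * indicator (G (Suc t)) \<omega> \<partial>M)"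
      using t by (intro nn_integral_add[symmetric]) auto
    also have "\<dots> \<le> (\<integral>\<^sup>+\<omega>. N 0 \<omega> \<partial>M)"
      using stop[of t] Suc by (auto intro: order_trans)
    finally show ?case .
  qed
  \<comment> \<open>\<open>B (Suc K)\<close> includes a crossing at time \<open>K\<close> itself.
    This last freezing uses only \<open>stop\<close>, hence nothing about
    \<open>F K\<close>.\<close>
  have "a * emeasure M {\<omega> \<in> space M. \<exists>t\<le>K. a < N t \<omega>} = a * emeasure M (B (Suc K))"
    by (simp add: B_def less_Suc_eq_le)
  also have "\<dots> = (\<integral>\<^sup>+\<omega>. a * indicator (B (Suc K)) \<omega> \<partial>M)"
    by (simp add: nn_integral_cmult_indicator BM)
  also have "\<dots> \<le> (\<integral>\<^sup>+\<omega>. a * indicator (B (Suc K)) \<omega> + N K \<omega> * indicator (G (Suc K)) \<omega> \<partial>M)"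
    by (intro nn_integral_mono) simp
  also have "\<dots> \<le> (\<integral>\<^sup>+\<omega>. N 0 \<omega> \<partial>M)"
    using stop[of K] inv[of K] by (auto intro: order_trans)
  finally show ?thesis .
qed

text \<open>For infinite \<open>T\<close> the finite-horizon events increase to the full one, and
  continuity from below carries the uniform bound over.\<close>

lemma emeasure_ex_enat_le:
  assumes B: "\<And>t. enat t \<le> T \<Longrightarrow> {\<omega> \<in> space M. Q t \<omega>} \<in> sets M"
    and le: "\<And>K. enat K \<le> T \<Longrightarrow> emeasure M {\<omega> \<in> space M. \<exists>t\<le>K. Q t \<omega>} \<le> b"
  shows "emeasure M {\<omega> \<in> space M. \<exists>t. enat t \<le> T \<and> Q t \<omega>} \<le> b"
proof (cases T)
  case (enat K)
  then show ?thesis using le[of K] by simp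
next
  case infinity
  let ?B = "\<lambda>K. {\<omega> \<in> space M. \<exists>t\<le>K. Q t \<omega>}"
  have BM: "?B K \<in> sets M" for K
  proof -
    have "?B K = (\<Union>t\<in>{..K}. {\<omega> \<in> space M. Q t \<omega>})" by auto
    also have "\<dots> \<in> sets M" using B infinity by (intro sets.finite_UN) auto
    finally show ?thesis .
  qed
  have inc: "incseq ?B"
  proof (rule incseq_SucI)
    show "?B K \<subseteq> ?B (Suc K)" for K by (auto intro: le_SucI)
  qed
  have "(SUP K. emeasure M (?B K)) = emeasure M (\<Union>K. ?B K)"
    by (rule SUP_emeasure_incseq[OF image_subsetI inc]) (rule BM)
  also have "(\<Union>K. ?B K) = {\<omega> \<in> space M. \<exists>t. enat t \<le> T \<and> Q t \<omega>}"
    using infinity by auto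
  finally have "emeasure M {\<omega> \<in> space M. \<exists>t. enat t \<le> T \<and> Q t \<omega>} = (SUP K. emeasure M (?B K))"
    by simp
  also have "\<dots> \<le> b"
    using le infinity by (intro SUP_least) auto
  finally show ?thesis .
qed

section \<open>The Gaussian mixture of a regression\<close>

lemma space_info_alg [simp]: "space (info_alg \<Omega> Mr y t) = space \<Omega>"
  unfolding info_alg_def by (rule space_measure_of) auto

lemma sets_info_alg:
  "sets (info_alg \<Omega> Mr y t) = sigma_sets (space \<Omega>)
     ((\<Union>k\<in>{0..t}. {Mr k -` A \<inter> space \<Omega> | A. A \<in> sets borel})
      \<union> (\<Union>k\<in>{1..t}. {y k -` A \<inter> space \<Omega> | A. A \<in> sets borel}))"
  unfolding info_alg_def by (rule sets_measure_of) auto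

lemma measurable_info_alg:
  shows "k \<le> t \<Longrightarrow> Mr k \<in> borel_measurable (info_alg \<Omega> Mr y t)"
    and "1 \<le> k \<Longrightarrow> k \<le> t \<Longrightarrow> y k \<in> borel_measurable (info_alg \<Omega> Mr y t)"
  by (rule measurableI; force simp: sets_info_alg intro!: sigma_sets.Basic)+

lemma info_alg_mono: "s \<le> t \<Longrightarrow> sets (info_alg \<Omega> Mr y s) \<subseteq> sets (info_alg \<Omega> Mr y t)"
  unfolding sets_info_alg by (intro sigma_sets_mono' Un_mono UN_mono) auto

lemma subalgebra_info_alg:
  assumes "\<And>k. k \<le> t \<Longrightarrow> Mr k \<in> borel_measurable \<Omega>"
    and "\<And>k. k \<le> t \<Longrightarrow> y k \<in> borel_measurable \<Omega>"
  shows "subalgebra \<Omega> (info_alg \<Omega> Mr y t)"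
  unfolding subalgebra_def space_info_alg sets_info_alg
  using assms by (auto intro!: sets.sigma_sets_subset measurable_sets)

section \<open>Pathwise identities for the mixture\<close>

locale weighted_regression =
  fixes Mr :: "nat \<Rightarrow> 'a \<Rightarrow> real ^ 'n ^ 'm" and y :: "nat \<Rightarrow> 'a \<Rightarrow> real ^ 'm"
    and W :: "real ^ 'm ^ 'm" and P :: "real ^ 'n ^ 'n" and \<mu> \<theta> :: "real ^ 'n" and c :: real
  assumes W_pd: "sym_pos_def W" and P_pd: "sym_pos_def P" and c_pos: "c > 0"
begin

text \<open>Under the model the residuals are the noise; writing them through \<open>y\<close> and
  \<open>Mr\<close> makes the score measurable for the observed data.\<close>

definition score :: "nat \<Rightarrow> 'a \<Rightarrow> real ^ 'n" where
  "score t \<omega> = (\<Sum>k<t. (transpose (Mr k \<omega>) ** W) *v (y (Suc k) \<omega> - Mr k \<omega> *v \<theta>))"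

text \<open>The Gaussian weight (terms in \<open>P\<close>) and the exponential process share one
  exponent, so their quadratic forms merge into the precision \<open>P + Vmat\<close>.\<close>

definition tilt :: "nat \<Rightarrow> real ^ 'n \<Rightarrow> 'a \<Rightarrow> real" where
  "tilt t l \<omega> = exp ((l \<bullet> (P *v (\<mu> - \<theta>) + score t \<omega>)
     - l \<bullet> ((P + Vmat Mr W t \<omega>) *v l) / 2) / c\<^sup>2)"

text \<open>The Gaussian weight is left unnormalised; its constant reappears in the
  threshold.\<close>

definition mixture :: "nat \<Rightarrow> 'a \<Rightarrow> ennreal" where
  "mixture t \<omega> = (\<integral>\<^sup>+l. ennreal (tilt t l \<omega>) \<partial>lborel)"

lemma tilt_nonneg [simp]: "0 \<le> tilt t l \<omega>"
  by (simp add: tilt_def)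

lemma precision_pd: "sym_pos_def (P + Vmat Mr W t \<omega>)"
proof (induction t)
  case 0
  then show ?case using P_pd by (simp add: Vmat_def)
next
  case (Suc t)
  then show ?case
    using sym_pos_def_add_congruence[OF Suc W_pd, of "Mr t \<omega>"] by (simp add: Vmat_def add.assoc)
qed

lemma Vmat_vector: "Vmat Mr W t \<omega> *v x = (\<Sum>k<t. (transpose (Mr k \<omega>) ** W) *v (Mr k \<omega> *v x))"
  by (induction t)
    (simp_all add: Vmat_def matrix_vector_mult_add_rdistrib matrix_vector_mul_assoc)

text \<open>The normal equations of the estimator, with \<open>(P + Vmat) *v \<theta>\<close>
  subtracted from both sides.\<close>

lemma precision_error:
  "(P + Vmat Mr W t \<omega>) *v (theta_hat Mr y W \<mu> P t \<omega> - \<theta>) = P *v (\<mu> - \<theta>) + score t \<omega>"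
  by (simp add: theta_hat_def matrix_vector_mult_diff_distrib matrix_vector_mul_assoc
      sym_pos_def_matrix_inv[OF precision_pd] score_def sum_subtractf
      matrix_vector_mult_add_rdistrib Vmat_vector)

text \<open>By the normal equations the linear part of \<open>tilt\<close> is
  \<open>A *v (- e)\<close>, so this is the tilted Gaussian integral at \<open>- e\<close>; the
  quadratic form ignores the sign.\<close>

lemma mixture_eq:
  fixes t \<omega>
  defines "A \<equiv> P + Vmat Mr W t \<omega>" and "e \<equiv> \<theta> - theta_hat Mr y W \<mu> P t \<omega>"
  shows "mixture t \<omega> = ennreal (exp ((e \<bullet> (A *v e)) / (2 * c\<^sup>2))
    * (sqrt (2 * pi * c\<^sup>2) ^ CARD('n) / sqrt (det A)))"
proof -
  have quad: "(- e) \<bullet> (A *v (- e)) = e \<bullet> (A *v e)"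
    using matrix_vector_mult_scaleR[of A "-1" e] by simp
  have "A *v (- e) = P *v (\<mu> - \<theta>) + score t \<omega>"
    using precision_error[of t \<omega>] by (simp add: A_def e_def)
  then show ?thesis
    using nn_integral_gaussian_tilted[OF precision_pd c_pos, of t \<omega> "- e", folded A_def]
    unfolding quad by (simp add: mixture_def tilt_def A_def)
qed

text \<open>Take logarithms and multiply by \<open>2 * c\<^sup>2\<close>: the powers of
  \<open>2 * pi * c\<^sup>2\<close> cancel and the determinants combine into the ratio inside the
  radius. The threshold \<open>a\<close> is the prior-based bound on the initial mixture, divided by
  \<open>\<delta>\<close>.\<close>

lemma wnorm_le_beta_rad_iff:
  fixes c\<theta> \<delta> t \<omega>
  assumes \<delta>: "\<delta> > 0"
  defines "a \<equiv> exp (c\<theta>\<^sup>2 / (2 * c\<^sup>2)) * (sqrt (2 * pi * c\<^sup>2) ^ CARD('n) / sqrt (det P)) / \<delta>"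
  shows "wnorm (\<theta> - theta_hat Mr y W \<mu> P t \<omega>) (P + Vmat Mr W t \<omega>)
      \<le> beta_rad c\<theta> c \<delta> P (Vmat Mr W t \<omega>) \<longleftrightarrow> mixture t \<omega> \<le> ennreal a"
proof -
  let ?V = "Vmat Mr W t \<omega>"
  let ?A = "P + ?V"
  let ?e = "\<theta> - theta_hat Mr y W \<mu> P t \<omega>"
  define q where "q = ?e \<bullet> (?A *v ?e)"
  define K where "K = sqrt (2 * pi * c\<^sup>2) ^ CARD('n)"
  have K: "K > 0" using c_pos by (simp add: K_def)
  have dP: "det P > 0" and dA: "det ?A > 0"
    using sym_pos_def_det_pos P_pd precision_pd by blast+
  have "mat 1 + matrix_inv P ** ?V = matrix_inv P ** ?A"
    by (simp add: matrix_add_ldistrib sym_pos_def_matrix_inv[OF P_pd])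
  moreover have "det (matrix_inv P) = 1 / det P"
    using arg_cong[OF sym_pos_def_matrix_inv(2)[OF P_pd], of det] dP
    by (simp add: det_mul field_simps)
  ultimately have det_ratio: "det (mat 1 + matrix_inv P ** ?V) = det ?A / det P"
    by (simp add: det_mul)
  have "mixture t \<omega> \<le> ennreal a \<longleftrightarrow> exp (q / (2 * c\<^sup>2)) * (K / sqrt (det ?A)) \<le> a"
    unfolding mixture_eq q_def[symmetric] K_def[symmetric]
    using dP K \<delta> by (subst ennreal_le_iff) (simp_all add: a_def K_def[symmetric])
  also have "\<dots> \<longleftrightarrow> ln (exp (q / (2 * c\<^sup>2)) * (K / sqrt (det ?A))) \<le> ln a"
    using dP dA K \<delta> by (subst ln_le_cancel_iff) (simp_all add: a_def K_def[symmetric])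
  also have "ln (exp (q / (2 * c\<^sup>2)) * (K / sqrt (det ?A))) = q / (2 * c\<^sup>2) + ln K - ln (det ?A) / 2"
    using dA K by (simp add: ln_mult ln_div ln_sqrt)
  also have "ln a = c\<theta>\<^sup>2 / (2 * c\<^sup>2) + ln K - ln (det P) / 2 + ln (1 / \<delta>)"
    using dP K \<delta> by (simp add: a_def K_def[symmetric] ln_mult ln_div ln_sqrt)
  also have "q / (2 * c\<^sup>2) + ln K - ln (det ?A) / 2 \<le> \<dots>
      \<longleftrightarrow> (2 * c\<^sup>2) * (q / (2 * c\<^sup>2) + ln K - ln (det ?A) / 2)
        \<le> (2 * c\<^sup>2) * (c\<theta>\<^sup>2 / (2 * c\<^sup>2) + ln K - ln (det P) / 2 + ln (1 / \<delta>))"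
    using c_pos by (subst mult_le_cancel_left_pos) simp_all
  also have "(2 * c\<^sup>2) * (q / (2 * c\<^sup>2) + ln K - ln (det ?A) / 2)
      = q + 2 * c\<^sup>2 * ln K - c\<^sup>2 * ln (det ?A)"
    using c_pos by (simp add: field_simps)
  also have "(2 * c\<^sup>2) * (c\<theta>\<^sup>2 / (2 * c\<^sup>2) + ln K - ln (det P) / 2 + ln (1 / \<delta>))
      = c\<theta>\<^sup>2 + 2 * c\<^sup>2 * ln K - c\<^sup>2 * ln (det P) + 2 * c\<^sup>2 * ln (1 / \<delta>)"
    using c_pos by (simp add: field_simps)
  also have "q + 2 * c\<^sup>2 * ln K - c\<^sup>2 * ln (det ?A) \<le> \<dots>
      \<longleftrightarrow> q \<le> c\<theta>\<^sup>2 + c\<^sup>2 * (ln (det ?A) - ln (det P)) + 2 * c\<^sup>2 * ln (1 / \<delta>)"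
    by (auto simp: right_diff_distrib)
  \<comment> \<open>HOL's \<open>sqrt\<close> is strictly increasing on all reals, so roots compare
    as radicands do, whatever their signs.\<close>
  also have "\<dots> \<longleftrightarrow> wnorm ?e ?A \<le> beta_rad c\<theta> c \<delta> P ?V"
    using dP dA by (simp add: wnorm_def beta_rad_def q_def det_ratio ln_div)
  finally show ?thesis by simp
qed

section \<open>Measurability and the supermartingale step\<close>

lemma score_measurable:
  assumes [measurable]: "\<And>k. k < t \<Longrightarrow> Mr k \<in> borel_measurable M"
    "\<And>k. k < t \<Longrightarrow> y (Suc k) \<in> borel_measurable M"
  shows "score t \<in> borel_measurable M"
  unfolding score_def by (intro borel_measurable_sum) measurable

lemma Vmat_measurable:
  assumes [measurable]: "\<And>k. k < t \<Longrightarrow> Mr k \<in> borel_measurable M"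
  shows "Vmat Mr W t \<in> borel_measurable M"
  unfolding Vmat_def by (intro borel_measurable_sum) measurable

lemma tilt_measurable:
  assumes "\<And>k. k < t \<Longrightarrow> Mr k \<in> borel_measurable M"
    "\<And>k. k < t \<Longrightarrow> y (Suc k) \<in> borel_measurable M"
  shows "(\<lambda>(\<omega>, l). tilt t l \<omega>) \<in> borel_measurable (M \<Otimes>\<^sub>M borel)"
proof -
  note [measurable] = score_measurable[OF assms] Vmat_measurable[OF assms(1)]
  show ?thesis unfolding tilt_def by measurable
qed

lemma mixture_measurable:
  assumes "\<And>k. k < t \<Longrightarrow> Mr k \<in> borel_measurable M"
    "\<And>k. k < t \<Longrightarrow> y (Suc k) \<in> borel_measurable M"
  shows "mixture t \<in> borel_measurable M"
proof -
  have [measurable]: "(\<lambda>(\<omega>, l). tilt t l \<omega>) \<in> borel_measurable (M \<Otimes>\<^sub>M lborel)"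
    using tilt_measurable[OF assms] by simp
  show ?thesis unfolding mixture_def by measurable
qed

text \<open>The direction \<open>\<nu>\<close> is chosen so that
  \<open>\<nu> \<bullet> w \<omega>\<close> is the increment of the score term and the sub-Gaussian
  exponent is exactly the quadratic term that \<open>Vmat\<close> gains.\<close>

lemma tilt_Suc:
  fixes l
  assumes "y (Suc t) \<omega> = Mr t \<omega> *v \<theta> + w \<omega>"
  defines "\<nu> \<equiv> (1 / c\<^sup>2) *\<^sub>R (W *v (Mr t \<omega> *v l))"
  shows "tilt (Suc t) l \<omega>
    = tilt t l \<omega> * exp (\<nu> \<bullet> w \<omega> - 1/2 * c\<^sup>2 * (\<nu> \<bullet> (matrix_inv W *v \<nu>)))"
proof -
  let ?z = "Mr t \<omega> *v l"
  have "matrix_inv W *v (W *v ?z) = ?z"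
    by (subst matrix_vector_mul_assoc) (simp add: sym_pos_def_matrix_inv[OF W_pd])
  then have "matrix_inv W *v \<nu> = (1 / c\<^sup>2) *\<^sub>R ?z"
    by (simp add: \<nu>_def matrix_vector_mult_scaleR)
  then have quad: "1/2 * c\<^sup>2 * (\<nu> \<bullet> (matrix_inv W *v \<nu>)) = (?z \<bullet> (W *v ?z)) / 2 / c\<^sup>2"
    using c_pos by (simp add: \<nu>_def power2_eq_square field_simps inner_commute)
  have pull: "l \<bullet> ((transpose (Mr t \<omega>) ** W) *v u) = ?z \<bullet> (W *v u)" for u
    by (simp only: inner_matrix_vector_left matrix_vector_mul_assoc)
  have "\<nu> \<bullet> w \<omega> = ((W *v ?z) \<bullet> w \<omega>) / c\<^sup>2"
    by (simp add: \<nu>_def)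
  also have "(W *v ?z) \<bullet> w \<omega> = l \<bullet> ((transpose (Mr t \<omega>) ** W) *v w \<omega>)"
    using sym_pos_def_inner_commute[OF W_pd, of "w \<omega>" ?z] by (simp add: pull inner_commute)
  finally have lin: "\<nu> \<bullet> w \<omega> = (l \<bullet> ((transpose (Mr t \<omega>) ** W) *v w \<omega>)) / c\<^sup>2" .
  have "score (Suc t) \<omega> = score t \<omega> + (transpose (Mr t \<omega>) ** W) *v w \<omega>"
    by (simp add: score_def assms(1))
  moreover have "l \<bullet> ((P + Vmat Mr W (Suc t) \<omega>) *v l)
      = l \<bullet> ((P + Vmat Mr W t \<omega>) *v l) + ?z \<bullet> (W *v ?z)"
    by (simp add: Vmat_vector matrix_vector_mult_add_rdistrib inner_add_right pull)
  ultimately show ?thesis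
    unfolding tilt_def lin quad exp_add[symmetric]
    by (simp add: inner_add_right add_divide_distrib diff_divide_distrib)
qed

text \<open>Tonelli moves the integral over \<open>l\<close> outside, leaving a one-step bound for
  each \<open>l\<close>. Its direction involves \<open>Mr t\<close>, so \<open>F\<close> has to know
  the regressors up to time \<open>t\<close>, whereas \<open>y (Suc t)\<close> is only
  \<open>\<Omega>\<close>-measurable.\<close>

lemma mixture_supermartingale:
  assumes "prob_space \<Omega>" and sub: "subalgebra \<Omega> F"
    and Mr_F: "\<And>k. k \<le> t \<Longrightarrow> Mr k \<in> borel_measurable F"
    and y_F: "\<And>k. k < t \<Longrightarrow> y (Suc k) \<in> borel_measurable F"
    and y_Suc: "y (Suc t) \<in> borel_measurable \<Omega>"
    and w: "w \<in> borel_measurable \<Omega>"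
    and model: "\<And>\<omega>. \<omega> \<in> space \<Omega> \<Longrightarrow> y (Suc t) \<omega> = Mr t \<omega> *v \<theta> + w \<omega>"
    and subgauss: "\<And>\<nu>. AE \<omega> in \<Omega>. nn_cond_exp \<Omega> F (\<lambda>\<omega>. ennreal (exp (\<nu> \<bullet> w \<omega>))) \<omega>
      \<le> ennreal (exp (1/2 * c\<^sup>2 * (\<nu> \<bullet> (matrix_inv W *v \<nu>))))"
    and A: "A \<in> sets F"
  shows "(\<integral>\<^sup>+\<omega>\<in>A. mixture (Suc t) \<omega> \<partial>\<Omega>) \<le> (\<integral>\<^sup>+\<omega>\<in>A. mixture t \<omega> \<partial>\<Omega>)"
proof -
  interpret prob_space \<Omega> by fact
  interpret finite_measure_subalgebra \<Omega> F by unfold_locales (rule sub)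
  interpret pair: pair_sigma_finite \<Omega> "lborel :: (real ^ 'n) measure" ..
  have Mr_\<Omega>: "Mr k \<in> borel_measurable \<Omega>" if "k \<le> t" for k
    using measurable_from_subalg[OF sub Mr_F[OF that]] .
  have y_\<Omega>: "y (Suc k) \<in> borel_measurable \<Omega>" if "k \<le> t" for k
    using that measurable_from_subalg[OF sub y_F] y_Suc by (cases "k = t") auto
  have A\<Omega>[measurable]: "A \<in> sets \<Omega>" using A sub by (auto simp: subalgebra_def)
  have swap: "(\<integral>\<^sup>+\<omega>\<in>A. mixture s \<omega> \<partial>\<Omega>)
      = (\<integral>\<^sup>+l. \<integral>\<^sup>+\<omega>. ennreal (tilt s l \<omega> * indicator A \<omega>) \<partial>\<Omega> \<partial>lborel)" if "s \<le> Suc t" for s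
  proof -
    have [measurable]: "(\<lambda>(\<omega>, l). tilt s l \<omega>) \<in> borel_measurable (\<Omega> \<Otimes>\<^sub>M lborel)"
      using tilt_measurable[of s \<Omega>] Mr_\<Omega> y_\<Omega> that by simp
    have "(\<integral>\<^sup>+\<omega>\<in>A. mixture s \<omega> \<partial>\<Omega>)
        = (\<integral>\<^sup>+\<omega>. \<integral>\<^sup>+l. ennreal (tilt s l \<omega> * indicator A \<omega>) \<partial>lborel \<partial>\<Omega>)"
      unfolding mixture_def
      by (intro nn_integral_cong) (auto simp: indicator_def)
    also have "\<dots> = (\<integral>\<^sup>+l. \<integral>\<^sup>+\<omega>. ennreal (tilt s l \<omega> * indicator A \<omega>) \<partial>\<Omega> \<partial>lborel)"
      by (rule pair.Fubini'[symmetric]) measurable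
    finally show ?thesis .
  qed
  have "(\<integral>\<^sup>+\<omega>\<in>A. mixture (Suc t) \<omega> \<partial>\<Omega>)
      = (\<integral>\<^sup>+l. \<integral>\<^sup>+\<omega>. ennreal (tilt (Suc t) l \<omega> * indicator A \<omega>) \<partial>\<Omega> \<partial>lborel)"
    by (rule swap) simp
  also have "\<dots> \<le> (\<integral>\<^sup>+l. \<integral>\<^sup>+\<omega>. ennreal (tilt t l \<omega> * indicator A \<omega>) \<partial>\<Omega> \<partial>lborel)"
  proof (rule nn_integral_mono)
    fix l
    let ?q = "\<lambda>\<eta>. 1/2 * c\<^sup>2 * (\<eta> \<bullet> (matrix_inv W *v \<eta>))"
    let ?\<nu> = "\<lambda>\<omega>. (1 / c\<^sup>2) *\<^sub>R (W *v (Mr t \<omega> *v l))"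
    have [measurable]: "(\<lambda>\<omega>. tilt t l \<omega>) \<in> borel_measurable F"
    proof -
      have [measurable]: "score t \<in> borel_measurable F" "Vmat Mr W t \<in> borel_measurable F"
        using Mr_F y_F by (auto intro!: score_measurable Vmat_measurable)
      show ?thesis unfolding tilt_def by measurable
    qed
    note [measurable] = Mr_F[OF order_refl] A
    \<comment> \<open>The tilt at time \<open>t\<close> times the indicator of \<open>A\<close>
      serves as the \<open>F\<close>-measurable factor \<open>Z\<close>.\<close>
    have "(\<integral>\<^sup>+\<omega>. ennreal (tilt (Suc t) l \<omega> * indicator A \<omega>) \<partial>\<Omega>)
        = (\<integral>\<^sup>+\<omega>. ennreal ((tilt t l \<omega> * indicator A \<omega>) * exp (?\<nu> \<omega> \<bullet> w \<omega> - ?q (?\<nu> \<omega>))) \<partial>\<Omega>)"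
      by (intro nn_integral_cong) (simp add: tilt_Suc[where w=w, OF model])
    also have "\<dots> \<le> (\<integral>\<^sup>+\<omega>. ennreal (tilt t l \<omega> * indicator A \<omega>) \<partial>\<Omega>)"
    proof (rule nn_integral_exp_tilt[OF w subgauss])
      show "continuous_on UNIV ?q" by (intro continuous_intros)
      show "(\<lambda>\<omega>. tilt t l \<omega> * indicator A \<omega>) \<in> borel_measurable F" by measurable
      show "0 \<le> tilt t l \<omega> * indicator A \<omega>" for \<omega> by simp
      show "?\<nu> \<in> borel_measurable F" by measurable
    qed
    finally show "(\<integral>\<^sup>+\<omega>. ennreal (tilt (Suc t) l \<omega> * indicator A \<omega>) \<partial>\<Omega>)
      \<le> (\<integral>\<^sup>+\<omega>. ennreal (tilt t l \<omega> * indicator A \<omega>) \<partial>\<Omega>)" .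
  qed
  also have "\<dots> = (\<integral>\<^sup>+\<omega>\<in>A. mixture t \<omega> \<partial>\<Omega>)"
    by (rule swap[symmetric]) simp
  finally show ?thesis .
qed

end

section \<open>Time-uniform confidence ellipsoids\<close>

theorem theorem2:
  fixes \<Omega> :: "'a measure"
    and T :: enat
    and Mr :: "nat \<Rightarrow> 'a \<Rightarrow> real ^ 'n ^ 'm"
    and y :: "nat \<Rightarrow> 'a \<Rightarrow> real ^ 'm"
    and w :: "nat \<Rightarrow> 'a \<Rightarrow> real ^ 'm"
    and \<theta>s \<mu> :: "real ^ 'n"
    and W :: "real ^ 'm ^ 'm"
    and P :: "real ^ 'n ^ 'n"
    and cw c\<theta> \<delta> :: real
  assumes prob: "prob_space \<Omega>"
    and Mr_meas: "\<And>t. enat t < T \<Longrightarrow> Mr t \<in> borel_measurable \<Omega>"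
    and w_meas: "\<And>t. enat t < T \<Longrightarrow> w t \<in> borel_measurable \<Omega>"
    and y_meas: "\<And>t. enat t \<le> T \<Longrightarrow> y t \<in> borel_measurable \<Omega>"
    and model: "\<And>t \<omega>. enat t < T \<Longrightarrow> \<omega> \<in> space \<Omega> \<Longrightarrow> y (Suc t) \<omega> = Mr t \<omega> *v \<theta>s + w t \<omega>"
    and W_pd: "sym_pos_def W"
    and P_pd: "sym_pos_def P"
    and cw_pos: "cw > 0"
    and subgauss: "\<And>t \<nu>. enat t < T \<Longrightarrow>
          AE \<omega> in \<Omega>. nn_cond_exp \<Omega> (info_alg \<Omega> Mr y t) (\<lambda>\<omega>'. ennreal (exp (\<nu> \<bullet> w t \<omega>'))) \<omega>
                \<le> ennreal (exp (1/2 * cw\<^sup>2 * (\<nu> \<bullet> (matrix_inv W *v \<nu>))))"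
    and c\<theta>_nonneg: "c\<theta> \<ge> 0"
    and prior: "wnorm (\<theta>s - \<mu>) P \<le> c\<theta>"
    and \<delta>_pos: "0 < \<delta>" and \<delta>_lt1: "\<delta> < 1"
  shows "measure \<Omega> {\<omega> \<in> space \<Omega>. \<forall>t. enat t \<le> T \<longrightarrow>
            wnorm (\<theta>s - theta_hat Mr y W \<mu> P t \<omega>) (P + Vmat Mr W t \<omega>)
              \<le> beta_rad c\<theta> cw \<delta> P (Vmat Mr W t \<omega>)} \<ge> 1 - \<delta>"
proof -
  interpret \<Omega>: prob_space \<Omega> by (rule prob)
  interpret weighted_regression Mr y W P \<mu> \<theta>s cw
    using W_pd P_pd cw_pos by unfold_locales
  define b where "b = sqrt (2 * pi * cw\<^sup>2) ^ CARD('n) / sqrt (det P)"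
  define a where "a = exp (c\<theta>\<^sup>2 / (2 * cw\<^sup>2)) * b / \<delta>"
  have b: "b > 0" using cw_pos sym_pos_def_det_pos[OF P_pd] by (simp add: b_def)
  have a: "a > 0" using b \<delta>_pos by (simp add: a_def)
  \<comment> \<open>The mixture at time \<open>t\<close> uses regressors before \<open>t\<close> and
    outputs up to \<open>t\<close>, so it is measurable even at \<open>t = T\<close>.\<close>
  have meas: "mixture t \<in> borel_measurable \<Omega>" if t: "enat t \<le> T" for t
  proof (rule mixture_measurable)
    fix k assume "k < t"
    then have "enat k < T" "enat (Suc k) \<le> T"
      using t by (cases T; simp)+
    then show "Mr k \<in> borel_measurable \<Omega>" "y (Suc k) \<in> borel_measurable \<Omega>"
      using Mr_meas y_meas by auto
  qed
  \<comment> \<open>At time \<open>0\<close> the precision is \<open>P\<close> and the estimate is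
    \<open>\<mu>\<close>, so the prior bound controls the exponent; \<open>a\<close> was chosen to
    make the result \<open>a * \<delta>\<close>.\<close>
  have initial: "mixture 0 \<omega> \<le> ennreal (a * \<delta>)" for \<omega>
  proof -
    have "sqrt ((\<theta>s - \<mu>) \<bullet> (P *v (\<theta>s - \<mu>))) \<le> sqrt (c\<theta>\<^sup>2)"
      using prior c\<theta>_nonneg by (simp add: wnorm_def)
    then have d: "(\<theta>s - \<mu>) \<bullet> (P *v (\<theta>s - \<mu>)) \<le> c\<theta>\<^sup>2"
      by (simp only: real_sqrt_le_iff)
    have P0: "P + Vmat Mr W 0 \<omega> = P" by (simp add: Vmat_def)
    have "theta_hat Mr y W \<mu> P 0 \<omega> = \<mu>"
      unfolding theta_hat_def P0
      by (simp add: matrix_vector_mul_assoc sym_pos_def_matrix_inv[OF P_pd])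
    then have "mixture 0 \<omega> = ennreal (exp (((\<theta>s - \<mu>) \<bullet> (P *v (\<theta>s - \<mu>))) / (2 * cw\<^sup>2)) * b)"
      by (simp only: mixture_eq P0 b_def)
    also have "\<dots> \<le> ennreal (a * \<delta>)"
      using d b \<delta>_pos cw_pos by (intro ennreal_leI) (simp add: a_def divide_right_mono)
    finally show ?thesis .
  qed
  \<comment> \<open>The maximal inequality gives \<open>a\<close> times the probability at most
    \<open>a * \<delta>\<close>, and \<open>a\<close> is positive and finite.\<close>
  have horizon: "emeasure \<Omega> {\<omega> \<in> space \<Omega>. \<exists>t\<le>K. ennreal a < mixture t \<omega>} \<le> ennreal \<delta>"
    if K: "enat K \<le> T" for K
  proof -
    have less: "enat t < T" if "t < K" for t
      using that K by (cases T) simp_all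
    have le: "enat t \<le> T" if "t \<le> K" for t
      using that K by (cases T) simp_all
    have sub: "subalgebra \<Omega> (info_alg \<Omega> Mr y t)" if "t < K" for t
      using that by (intro subalgebra_info_alg Mr_meas y_meas less le) auto
    have "ennreal a * emeasure \<Omega> {\<omega> \<in> space \<Omega>. \<exists>t\<le>K. ennreal a < mixture t \<omega>}
        \<le> (\<integral>\<^sup>+\<omega>. mixture 0 \<omega> \<partial>\<Omega>)"
    proof (rule nn_supermartingale_maximal[where F="info_alg \<Omega> Mr y"])
      fix t assume t: "t < K"
      show "subalgebra \<Omega> (info_alg \<Omega> Mr y t)" using t by (rule sub)
      show "mixture t \<in> borel_measurable (info_alg \<Omega> Mr y t)"
        by (rule mixture_measurable) (auto intro: measurable_info_alg)
      fix A assume "A \<in> sets (info_alg \<Omega> Mr y t)"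
      then show "(\<integral>\<^sup>+\<omega>\<in>A. mixture (Suc t) \<omega> \<partial>\<Omega>) \<le> (\<integral>\<^sup>+\<omega>\<in>A. mixture t \<omega> \<partial>\<Omega>)"
        using t by (intro mixture_supermartingale[OF prob sub[OF t] _ _ _ w_meas model subgauss]
            measurable_info_alg y_meas less le) auto
    qed (use meas[OF K] in \<open>simp_all add: info_alg_mono\<close>)
    also have "\<dots> \<le> (\<integral>\<^sup>+\<omega>. ennreal (a * \<delta>) \<partial>\<Omega>)"
      by (intro nn_integral_mono initial)
    also have "\<dots> = ennreal a * ennreal \<delta>"
      using a \<delta>_pos by (simp add: \<Omega>.emeasure_space_1 ennreal_mult)
    finally show ?thesis
      using a by (simp add: ennreal_mult_le_mult_iff)
  qed
  let ?bad = "{\<omega> \<in> space \<Omega>. \<exists>t. enat t \<le> T \<and> ennreal a < mixture t \<omega>}"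
  have bad_sets: "{\<omega> \<in> space \<Omega>. ennreal a < mixture t \<omega>} \<in> sets \<Omega>" if "enat t \<le> T" for t
    using meas[OF that] by measurable
  have "?bad = (\<Union>t\<in>{t. enat t \<le> T}. {\<omega> \<in> space \<Omega>. ennreal a < mixture t \<omega>})" by auto
  also have "\<dots> \<in> sets \<Omega>"
    using bad_sets by (intro sets.countable_UN') auto
  finally have bad: "?bad \<in> sets \<Omega>" .
  have "emeasure \<Omega> ?bad \<le> ennreal \<delta>"
    using bad_sets horizon by (rule emeasure_ex_enat_le)
  then have "measure \<Omega> ?bad \<le> \<delta>"
    using \<delta>_pos by (simp add: \<Omega>.emeasure_eq_measure)
  then have "1 - \<delta> \<le> measure \<Omega> (space \<Omega> - ?bad)"
    by (simp add: \<Omega>.prob_compl[OF bad])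
  \<comment> \<open>By the equivalence with the threshold, the confidence event is exactly the
    complement of the crossing event, with no loss in probability.\<close>
  also have "space \<Omega> - ?bad = {\<omega> \<in> space \<Omega>. \<forall>t. enat t \<le> T \<longrightarrow>
      wnorm (\<theta>s - theta_hat Mr y W \<mu> P t \<omega>) (P + Vmat Mr W t \<omega>)
        \<le> beta_rad c\<theta> cw \<delta> P (Vmat Mr W t \<omega>)}"
    unfolding wnorm_le_beta_rad_iff[OF \<delta>_pos] a_def[symmetric, unfolded b_def]
    by (auto simp: not_less)
  finally show ?thesis .
qed

end
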